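(* Let $\alpha\in(0,1)$, $\theta>0$, $\lambda_1,\lambda_2>0$, and let $\{\mathcal Q^{\alpha,\theta}(t)\}_{t\ge0}$ be the bivariate tempered space-fractional Poisson process with these parameters. For $\mathbf u=(u_1,u_2)\in[0,1]^2$ and $t\ge0$, its probability generating function $G^{\alpha,\theta}(\mathbf u;t)=\sum_{k_1,k_2\ge0}u_1^{k_1}u_2^{k_2}\,\mathbb P\{\mathcal Q^{\alpha,\theta}(t)=(k_1,k_2)\}$ is given by $$G^{\alpha,\theta}(\mathbf u;t)=\exp\Big(-t\big([\lambda_1(1-u_1)+\lambda_2(1-u_2)+\theta]^\alpha-\theta^\alpha\big)\Big),$$ and it satisfies the differential equation $$\frac{d}{dt}G^{\alpha,\theta}(\mathbf u;t)=-\big([\lambda_1(1-u_1)+\lambda_2(1-u_2)+\theta]^\alpha-\theta^\alpha\big)\,G^{\alpha,\theta}(\mathbf u;t),\qquad G^{\alpha,\theta}(\mathbf u;0)=1.$$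
   Context: The tempered $\alpha$-stable subordinator $\{S^{\alpha,\theta}(t)\}_{t\ge0}$ is the Lévy subordinator with $\mathbb E[e^{-uS^{\alpha,\theta}(t)}]=e^{-t((u+\theta)^\alpha-\theta^\alpha)}$, $u\ge0$. Let $\{\mathcal N_i(t,\lambda_i)\}_{t\ge0}$, $i=1,2$, be independent homogeneous Poisson processes with rates $\lambda_i$, independent of $S^{\alpha,\theta}$. The bivariate tempered space-fractional Poisson process is $\mathcal Q^{\alpha,\theta}(t)=(\mathcal N_1(S^{\alpha,\theta}(t),\lambda_1),\mathcal N_2(S^{\alpha,\theta}(t),\lambda_2))$. The convention $0^0=1$ is used. *)

theory Defs
  imports "HOL-Probability.Probability"
begin

text \<open>
  Processes are functions of time and outcome, \<open>X t \<omega>\<close>. Time is a real number, and only the values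
  at \<open>t \<ge> 0\<close> are meaningful. Path properties are required for every outcome, so that a process
  evaluated at a random time is again measurable; \<open>X 0 = 0\<close> is only required almost surely.
\<close>

definition cadlag :: "(real \<Rightarrow> real) \<Rightarrow> bool" where
  "cadlag f \<longleftrightarrow>
     (\<forall>t\<ge>0. (f \<longlongrightarrow> f t) (at_right t)) \<and> (\<forall>t>0. \<exists>l. (f \<longlongrightarrow> l) (at_left t))"

definition independent_increments :: "'a measure \<Rightarrow> (real \<Rightarrow> 'a \<Rightarrow> real) \<Rightarrow> bool" where
  "independent_increments M X \<longleftrightarrow>
     (\<forall>(n::nat) \<tau>::nat \<Rightarrow> real. 0 \<le> \<tau> 0 \<and> (\<forall>i<n. \<tau> i \<le> \<tau> (Suc i)) \<longrightarrow>
        prob_space.indep_vars M (\<lambda>_. borel) (\<lambda>i \<omega>. X (\<tau> (Suc i)) \<omega> - X (\<tau> i) \<omega>) {..<n})"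

definition stationary_increments :: "'a measure \<Rightarrow> (real \<Rightarrow> 'a \<Rightarrow> real) \<Rightarrow> bool" where
  "stationary_increments M X \<longleftrightarrow>
     (\<forall>s t. 0 \<le> s \<and> s \<le> t \<longrightarrow>
        distr M borel (\<lambda>\<omega>. X t \<omega> - X s \<omega>) = distr M borel (X (t - s)))"

text \<open>Stochastic continuity is not listed, as it follows from the other conditions.\<close>

definition levy_process :: "'a measure \<Rightarrow> (real \<Rightarrow> 'a \<Rightarrow> real) \<Rightarrow> bool" where
  "levy_process M X \<longleftrightarrow>
     (\<forall>t\<ge>0. X t \<in> borel_measurable M) \<and>
     (AE \<omega> in M. X 0 \<omega> = 0) \<and>
     independent_increments M X \<and>
     stationary_increments M X \<and>
     (\<forall>\<omega>\<in>space M. cadlag (\<lambda>t. X t \<omega>))"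

definition levy_subordinator :: "'a measure \<Rightarrow> (real \<Rightarrow> 'a \<Rightarrow> real) \<Rightarrow> bool" where
  "levy_subordinator M S \<longleftrightarrow>
     levy_process M S \<and>
     (\<forall>\<omega>\<in>space M. (\<forall>t\<ge>0. 0 \<le> S t \<omega>) \<and> mono_on {0..} (\<lambda>t. S t \<omega>))"

definition tempered_stable_subordinator ::
    "'a measure \<Rightarrow> real \<Rightarrow> real \<Rightarrow> (real \<Rightarrow> 'a \<Rightarrow> real) \<Rightarrow> bool" where
  "tempered_stable_subordinator M \<alpha> \<theta> S \<longleftrightarrow>
     levy_subordinator M S \<and>
     (\<forall>t\<ge>0. \<forall>u\<ge>0.
        (\<integral>\<omega>. exp (- u * S t \<omega>) \<partial>M) = exp (- t * ((u + \<theta>) powr \<alpha> - \<theta> powr \<alpha>)))"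

text \<open>
  By stationarity, every increment of a Poisson process over an interval of length \<open>t\<close> has the
  Poisson distribution with parameter \<open>r * t\<close>. The case \<open>t = 0\<close> is excluded since
  \<^const>\<open>poisson_pmf\<close> is only specified for positive parameters.
\<close>

definition poisson_process :: "'a measure \<Rightarrow> real \<Rightarrow> (real \<Rightarrow> 'a \<Rightarrow> nat) \<Rightarrow> bool" where
  "poisson_process M r N \<longleftrightarrow>
     levy_process M (\<lambda>t \<omega>. real (N t \<omega>)) \<and>
     (\<forall>\<omega>\<in>space M. mono_on {0..} (\<lambda>t. N t \<omega>)) \<and>
     (\<forall>t>0. distr M (count_space UNIV) (N t) = measure_pmf (poisson_pmf (r * t)))"

text \<open>Mutual independence of whole processes, as random elements of the path space.\<close>

definition indep_processes ::
    "'a measure \<Rightarrow> ('i \<Rightarrow> real \<Rightarrow> 'a \<Rightarrow> real) \<Rightarrow> 'i set \<Rightarrow> bool" where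
  "indep_processes M X I \<longleftrightarrow>
     prob_space.indep_vars M (\<lambda>_. Pi\<^sub>M {0..} (\<lambda>_. borel)) (\<lambda>i \<omega>. \<lambda>t\<in>{0..}. X i t \<omega>) I"

definition bivariate_time_change ::
    "(real \<Rightarrow> 'a \<Rightarrow> nat) \<Rightarrow> (real \<Rightarrow> 'a \<Rightarrow> nat) \<Rightarrow> (real \<Rightarrow> 'a \<Rightarrow> real) \<Rightarrow> real \<Rightarrow> 'a \<Rightarrow> nat \<times> nat" where
  "bivariate_time_change N1 N2 S t \<omega> = (N1 (S t \<omega>) \<omega>, N2 (S t \<omega>) \<omega>)"

definition bivariate_tempered_space_fractional_poisson ::
    "'a measure \<Rightarrow> real \<Rightarrow> real \<Rightarrow> real \<Rightarrow> real \<Rightarrow> (real \<Rightarrow> 'a \<Rightarrow> nat \<times> nat) \<Rightarrow> bool" where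
  "bivariate_tempered_space_fractional_poisson M \<alpha> \<theta> r1 r2 Q \<longleftrightarrow>
     (\<exists>S N1 N2.
        tempered_stable_subordinator M \<alpha> \<theta> S \<and>
        poisson_process M r1 N1 \<and>
        poisson_process M r2 N2 \<and>
        indep_processes M ((!) [S, \<lambda>t \<omega>. real (N1 t \<omega>), \<lambda>t \<omega>. real (N2 t \<omega>)]) {..<3} \<and>
        (\<forall>t\<ge>0. \<forall>\<omega>\<in>space M. Q t \<omega> = bivariate_time_change N1 N2 S t \<omega>))"

definition bivariate_pgf ::
    "'a measure \<Rightarrow> (real \<Rightarrow> 'a \<Rightarrow> nat \<times> nat) \<Rightarrow> real \<Rightarrow> real \<Rightarrow> real \<Rightarrow> real" where
  "bivariate_pgf M Q u1 u2 t =
     (\<Sum>\<^sub>\<infinity>(k1, k2)\<in>UNIV. u1 ^ k1 * u2 ^ k2 * measure M {\<omega> \<in> space M. Q t \<omega> = (k1, k2)})"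

end

theory Submission
  imports Defs
begin

text \<open>
  Conditionally on the subordinator, the pgf is the product of two Poisson pgfs at time \<open>S t\<close>, so it
  is the Laplace transform of \<open>S t\<close> at \<open>r1 * (1 - u1) + r2 * (1 - u2)\<close>. Evaluating a path at a random
  time is not measurable for the product \<open>\<sigma>\<close>-algebra on path space, so independence cannot be used
  there directly. Instead \<open>S t\<close> is approximated strictly from above by a random time on a grid, where
  independence is applied at each grid point; right-continuity of the paths and dominated
  convergence then give the limit.
\<close>

text \<open>For each outcome exactly one term of the series is nonzero, namely the one with index
  \<open>K \<omega>\<close>. The lemma splits an integral at a discrete random time into integrals
  at deterministic times.\<close>

lemma nn_integral_compose_count_space:
  fixes K :: "'a \<Rightarrow> nat" and Y :: "nat \<Rightarrow> 'a \<Rightarrow> ennreal"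
  assumes K: "K \<in> M \<rightarrow>\<^sub>M count_space UNIV" and Y: "\<And>k. Y k \<in> borel_measurable M"
  shows "(\<integral>\<^sup>+\<omega>. Y (K \<omega>) \<omega> \<partial>M) = (\<Sum>k. \<integral>\<^sup>+\<omega>. indicator {k} (K \<omega>) * Y k \<omega> \<partial>M)"
proof -
  have "Y (K \<omega>) \<omega> = (\<Sum>k. indicator {k} (K \<omega>) * Y k \<omega>)" for \<omega>
    by (subst suminf_finite[of "{K \<omega>}"]) auto
  then have "(\<integral>\<^sup>+\<omega>. Y (K \<omega>) \<omega> \<partial>M) = (\<integral>\<^sup>+\<omega>. (\<Sum>k. indicator {k} (K \<omega>) * Y k \<omega>) \<partial>M)"
    by simp
  also have "\<dots> = (\<Sum>k. \<integral>\<^sup>+\<omega>. indicator {k} (K \<omega>) * Y k \<omega> \<partial>M)"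
    by (intro nn_integral_suminf borel_measurable_times_ennreal Y measurable_compose[OF K]) simp
  finally show ?thesis .
qed

section \<open>Poisson processes at deterministic times\<close>

lemma poisson_pmf_pgf:
  fixes u :: real
  assumes "0 < r" "0 \<le> u"
  shows "(\<integral>\<^sup>+k. ennreal (u ^ k) \<partial>measure_pmf (poisson_pmf r)) = ennreal (exp (- r * (1 - u)))"
proof -
  have "(\<lambda>k. exp (- r) * ((r * u) ^ k /\<^sub>R fact k)) sums (exp (- r) * exp (r * u))"
    by (intro sums_mult exp_converges)
  then have s: "(\<lambda>k. pmf (poisson_pmf r) k * u ^ k) sums exp (- r * (1 - u))"
    using assms by (simp add: field_simps power_mult_distrib flip: exp_add)
  have "(\<integral>\<^sup>+k. ennreal (u ^ k) \<partial>measure_pmf (poisson_pmf r))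
      = (\<Sum>k. ennreal (pmf (poisson_pmf r) k * u ^ k))"
    \<comment> \<open>\<open>pmf_poisson\<close> is kept folded so that the terms retain the form
      they have in \<open>s\<close>.\<close>
    by (simp only: nn_integral_measure_pmf nn_integral_count_space_nat)
       (simp add: ennreal_mult' del: pmf_poisson)
  also have "\<dots> = ennreal (exp (- r * (1 - u)))"
    using assms by (intro suminf_ennreal_eq s) simp
  finally show ?thesis .
qed

lemma poisson_process_measurable:
  assumes "poisson_process M r N" "0 \<le> s"
  shows "N s \<in> M \<rightarrow>\<^sub>M count_space UNIV"
proof -
  have "(\<lambda>\<omega>. real (N s \<omega>)) \<in> borel_measurable M"
    using assms by (simp add: poisson_process_def levy_process_def)
  \<comment> \<open>Rounding undoes the embedding \<open>real\<close>, so Borel measurability of the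
    embedded process gives measurability of the counts.\<close>
  then have "(\<lambda>\<omega>. nat \<lfloor>real (N s \<omega>)\<rfloor>) \<in> M \<rightarrow>\<^sub>M count_space UNIV"
    by measurable
  then show ?thesis
    by simp
qed

lemma poisson_process_pgf:
  assumes "poisson_process M r N" "0 < r" "0 < s" "0 \<le> u"
  shows "(\<integral>\<^sup>+\<omega>. ennreal (u ^ N s \<omega>) \<partial>M) = ennreal (exp (- r * (1 - u) * s))"
proof -
  have m: "N s \<in> M \<rightarrow>\<^sub>M count_space UNIV"
    using assms by (intro poisson_process_measurable) auto
  have d: "distr M (count_space UNIV) (N s) = measure_pmf (poisson_pmf (r * s))"
    using assms by (simp add: poisson_process_def)
  have "(\<integral>\<^sup>+\<omega>. ennreal (u ^ N s \<omega>) \<partial>M)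
      = (\<integral>\<^sup>+k. ennreal (u ^ k) \<partial>distr M (count_space UNIV) (N s))"
    using m by (simp add: nn_integral_distr)
  also have "\<dots> = ennreal (exp (- r * (1 - u) * s))"
    unfolding d using assms by (simp add: poisson_pmf_pgf mult_ac)
  finally show ?thesis .
qed

text \<open>A right-continuous path with integer values is constant just to the right of each time.
  The inequality \<open>s < x n\<close> is strict because \<open>at_right s\<close> excludes
  \<open>s\<close> itself.\<close>

lemma poisson_process_right_continuous:
  assumes "poisson_process M r N" "\<omega> \<in> space M" "0 \<le> s"
    and "\<And>n. s < x n" "x \<longlonglongrightarrow> s"
  shows "\<forall>\<^sub>F n in sequentially. N (x n) \<omega> = N s \<omega>"
proof -
  have "((\<lambda>t. real (N t \<omega>)) \<longlongrightarrow> real (N s \<omega>)) (at_right s)"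
    using assms by (auto simp: poisson_process_def levy_process_def cadlag_def)
  moreover have "filterlim x (at_right s) sequentially"
    using assms by (intro tendsto_imp_filterlim_at_right) auto
  ultimately have "(\<lambda>n. real (N (x n) \<omega>)) \<longlonglongrightarrow> real (N s \<omega>)"
    by (rule filterlim_compose)
  \<comment> \<open>Distinct natural numbers are at distance at least 1, so a distance below 1
    forces equality.\<close>
  then have "\<forall>\<^sub>F n in sequentially. dist (real (N (x n) \<omega>)) (real (N s \<omega>)) < 1"
    by (rule tendstoD) simp
  then show ?thesis
    by eventually_elim (simp add: dist_real_def)
qed

section \<open>Approximation of a time strictly from above by grid points\<close>

definition grid_index :: "nat \<Rightarrow> real \<Rightarrow> nat" where
  "grid_index n s = nat \<lfloor>s * real (Suc n)\<rfloor>"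

text \<open>
  The successor makes the grid point lie strictly to the right of \<open>s\<close>; in particular it is positive,
  which avoids the time \<open>0\<close>, where the law of a Poisson process is not given as a Poisson distribution.
\<close>

definition grid_point :: "nat \<Rightarrow> nat \<Rightarrow> real" where
  "grid_point n k = real (Suc k) / real (Suc n)"

lemma grid_point_pos [simp]: "0 < grid_point n k"
  by (simp add: grid_point_def)

lemma grid_index_measurable [measurable]: "grid_index n \<in> borel \<rightarrow>\<^sub>M count_space UNIV"
  unfolding grid_index_def by measurable

lemma indicator_grid_index_measurable [measurable]:
  "(\<lambda>s. indicator {k} (grid_index n s) :: ennreal) \<in> borel_measurable borel"
  by (rule measurable_compose[OF grid_index_measurable]) simp

lemma grid_point_gt:
  assumes "0 \<le> s"
  shows "s < grid_point n (grid_index n s)"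
proof -
  have "0 \<le> s * real (Suc n)"
    using assms by simp
  then have "s * real (Suc n) < real (Suc (grid_index n s))"
    unfolding grid_index_def by linarith
  then show ?thesis
    by (simp add: grid_point_def pos_less_divide_eq del: of_nat_Suc)
qed

lemma grid_point_le:
  assumes "0 \<le> s"
  shows "grid_point n (grid_index n s) \<le> s + 1 / real (Suc n)"
proof -
  \<comment> \<open>Nonnegativity keeps \<open>nat\<close> from truncating the floor at 0, which
    would break the upper bound.\<close>
  have "0 \<le> s * real (Suc n)"
    using assms by simp
  then have "real (Suc (grid_index n s)) \<le> s * real (Suc n) + 1"
    unfolding grid_index_def by linarith
  then show ?thesis
    by (simp add: grid_point_def pos_divide_le_eq distrib_right del: of_nat_Suc)
qed

lemma grid_point_tendsto:
  assumes "0 \<le> s"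
  shows "(\<lambda>n. grid_point n (grid_index n s)) \<longlonglongrightarrow> s"
proof (rule tendsto_sandwich[where f = "\<lambda>_. s" and h = "\<lambda>n. s + 1 / real (Suc n)"])
  show "(\<lambda>n. s + 1 / real (Suc n)) \<longlonglongrightarrow> s"
    using tendsto_add[OF tendsto_const LIMSEQ_inverse_real_of_nat, of s]
    by (simp add: inverse_eq_divide)
qed (use grid_point_gt[OF assms] grid_point_le[OF assms] in
    \<open>auto intro!: always_eventually simp: less_imp_le simp del: of_nat_Suc\<close>)

section \<open>Poisson processes at an independent random time\<close>

context prob_space
begin

text \<open>The process at time \<open>T\<close> is the pointwise limit of its values at the grid
  times above \<open>T\<close>, by right-continuity of every path.\<close>

lemma poisson_process_random_time_measurable:
  assumes N: "poisson_process M r N"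
    and [measurable]: "T \<in> borel_measurable M" and T: "\<And>\<omega>. \<omega> \<in> space M \<Longrightarrow> 0 \<le> T \<omega>"
  shows "(\<lambda>\<omega>. N (T \<omega>) \<omega>) \<in> M \<rightarrow>\<^sub>M count_space UNIV"
proof -
  have "(\<lambda>\<omega>. real (N (T \<omega>) \<omega>)) \<in> borel_measurable M"
  proof (rule borel_measurable_LIMSEQ_real)
    fix n
    have [measurable]: "N (grid_point n k) \<in> M \<rightarrow>\<^sub>M count_space UNIV" for k
      by (intro poisson_process_measurable[OF N] less_imp_le) simp
    show "(\<lambda>\<omega>. real (N (grid_point n (grid_index n (T \<omega>))) \<omega>)) \<in> borel_measurable M"
      \<comment> \<open>The grid index takes countably many values, so measurability at each fixed
        grid time suffices.\<close>
      by (rule measurable_compose_countable) measurable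
  next
    fix \<omega> assume "\<omega> \<in> space M"
    then have "\<forall>\<^sub>F n in sequentially. N (grid_point n (grid_index n (T \<omega>))) \<omega> = N (T \<omega>) \<omega>"
      by (intro poisson_process_right_continuous[OF N] grid_point_gt grid_point_tendsto T)
    then show "(\<lambda>n. real (N (grid_point n (grid_index n (T \<omega>))) \<omega>)) \<longlonglongrightarrow> real (N (T \<omega>) \<omega>)"
      by (intro tendsto_eventually) (auto elim: eventually_mono)
  qed
  then have "(\<lambda>\<omega>. nat \<lfloor>real (N (T \<omega>) \<omega>)\<rfloor>) \<in> M \<rightarrow>\<^sub>M count_space UNIV"
    by measurable
  then show ?thesis
    by simp
qed

text \<open>Evaluation at a fixed time is a coordinate map of the path space, hence measurable, so
  independence of the paths passes to their values. Each process may be read at its own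
  time.\<close>

lemma nn_integral_indep_processes:
  fixes X :: "nat \<Rightarrow> real \<Rightarrow> 'a \<Rightarrow> real" and f :: "nat \<Rightarrow> real \<Rightarrow> ennreal"
  assumes indep: "indep_processes M X I" and "finite I"
    and \<tau>: "\<And>i. i \<in> I \<Longrightarrow> 0 \<le> \<tau> i"
    and [measurable]: "\<And>i. i \<in> I \<Longrightarrow> f i \<in> borel_measurable borel"
  shows "(\<integral>\<^sup>+\<omega>. (\<Prod>i\<in>I. f i (X i (\<tau> i) \<omega>)) \<partial>M) = (\<Prod>i\<in>I. \<integral>\<^sup>+\<omega>. f i (X i (\<tau> i) \<omega>) \<partial>M)"
proof -
  have "indep_vars (\<lambda>_. borel) (\<lambda>i \<omega>. f i ((\<lambda>t\<in>{0..}. X i t \<omega>) (\<tau> i))) I"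
  proof (rule indep_vars_compose2[OF indep[unfolded indep_processes_def]])
    fix i assume i: "i \<in> I"
    then have [measurable]: "(\<lambda>p. p (\<tau> i)) \<in> Pi\<^sub>M {0..} (\<lambda>_. borel) \<rightarrow>\<^sub>M (borel :: real measure)"
      using \<tau> by (intro measurable_component_singleton) auto
    show "(\<lambda>p. f i (p (\<tau> i))) \<in> Pi\<^sub>M {0..} (\<lambda>_. borel) \<rightarrow>\<^sub>M borel"
      using i by measurable
  qed
  then have "(\<integral>\<^sup>+\<omega>. (\<Prod>i\<in>I. f i ((\<lambda>t\<in>{0..}. X i t \<omega>) (\<tau> i))) \<partial>M)
      = (\<Prod>i\<in>I. \<integral>\<^sup>+\<omega>. f i ((\<lambda>t\<in>{0..}. X i t \<omega>) (\<tau> i)) \<partial>M)"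
    using \<open>finite I\<close> by (intro indep_vars_nn_integral) auto
  then show ?thesis
    using \<tau> by simp
qed

text \<open>This is the conditioning on the subordinator; the law of \<open>S t\<close> does not
  enter until its Laplace transform is inserted later.\<close>

lemma expectation_subordinated_poisson_processes:
  assumes N1: "poisson_process M r1 N1" and N2: "poisson_process M r2 N2"
    and r: "0 < r1" "0 < r2" and u: "u1 \<in> {0..1}" "u2 \<in> {0..1}" and t: "0 \<le> t"
    and S [measurable]: "S t \<in> borel_measurable M" and S_nn: "\<And>\<omega>. \<omega> \<in> space M \<Longrightarrow> 0 \<le> S t \<omega>"
    and indep: "indep_processes M ((!) [S, \<lambda>t \<omega>. real (N1 t \<omega>), \<lambda>t \<omega>. real (N2 t \<omega>)]) {..<3}"
  shows "expectation (\<lambda>\<omega>. u1 ^ N1 (S t \<omega>) \<omega> * u2 ^ N2 (S t \<omega>) \<omega>)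
       = expectation (\<lambda>\<omega>. exp (- (r1 * (1 - u1) + r2 * (1 - u2)) * S t \<omega>))"
proof -
  define c where "c = r1 * (1 - u1) + r2 * (1 - u2)"
  have c: "0 \<le> c"
    using r u by (simp add: c_def)
  define D where "D n \<omega> = grid_point n (grid_index n (S t \<omega>))" for n \<omega>
  have D_pos: "0 < D n \<omega>" for n \<omega>
    by (simp add: D_def)
  have D_gt: "S t \<omega> < D n \<omega>" and D_lim: "(\<lambda>n. D n \<omega>) \<longlonglongrightarrow> S t \<omega>" if "\<omega> \<in> space M" for n \<omega>
    using S_nn[OF that] by (auto simp: D_def intro: grid_point_gt grid_point_tendsto)
  have D_meas [measurable]: "D n \<in> borel_measurable M" for n
    unfolding D_def by measurable
  have grid_meas [measurable]:
    "N1 (grid_point n k) \<in> M \<rightarrow>\<^sub>M count_space UNIV"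
    "N2 (grid_point n k) \<in> M \<rightarrow>\<^sub>M count_space UNIV" for n k
    by (intro poisson_process_measurable[OF N1] poisson_process_measurable[OF N2] less_imp_le; simp)+
  have meas [measurable]:
    "(\<lambda>\<omega>. N1 (D n \<omega>) \<omega>) \<in> M \<rightarrow>\<^sub>M count_space UNIV"
    "(\<lambda>\<omega>. N2 (D n \<omega>) \<omega>) \<in> M \<rightarrow>\<^sub>M count_space UNIV"
    "(\<lambda>\<omega>. N1 (S t \<omega>) \<omega>) \<in> M \<rightarrow>\<^sub>M count_space UNIV"
    "(\<lambda>\<omega>. N2 (S t \<omega>) \<omega>) \<in> M \<rightarrow>\<^sub>M count_space UNIV" for n
    by (rule poisson_process_random_time_measurable[OF N1 D_meas less_imp_le[OF D_pos]]
        poisson_process_random_time_measurable[OF N2 D_meas less_imp_le[OF D_pos]]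
        poisson_process_random_time_measurable[OF N1 S S_nn]
        poisson_process_random_time_measurable[OF N2 S S_nn] | assumption)+
  \<comment> \<open>These bounds permit the passage between expectations and nonnegative integrals,
    and give the constant 1 as dominating function.\<close>
  have pw: "0 \<le> u1 ^ a * u2 ^ b" "u1 ^ a * u2 ^ b \<le> 1" for a b
    using u by (auto intro!: mult_le_one power_le_one)

  \<comment> \<open>Where the grid index equals \<open>k\<close>, the random time is the constant
    \<open>grid_point n k\<close>. The integrand is then a product of one factor per independent
    process, the indicator depending on \<open>S t\<close> alone.\<close>
  have cell: "(\<integral>\<^sup>+\<omega>. indicator {k} (grid_index n (S t \<omega>)) *
        ennreal (u1 ^ N1 (grid_point n k) \<omega> * u2 ^ N2 (grid_point n k) \<omega>) \<partial>M)
      = (\<integral>\<^sup>+\<omega>. indicator {k} (grid_index n (S t \<omega>)) * ennreal (exp (- c * grid_point n k)) \<partial>M)"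
    (is "?lhs = ?rhs") for n k
  proof -
    \<comment> \<open>One function per process, acting on real values; rounding recovers the counts.
      With \<open>\<tau>\<close>, the subordinator is read at \<open>t\<close> and both Poisson
      processes at the grid point.\<close>
    define f :: "nat \<Rightarrow> real \<Rightarrow> ennreal" where
      "f i = (if i = 0 then (\<lambda>x. indicator {k} (grid_index n x))
        else if i = 1 then (\<lambda>x. ennreal (u1 ^ nat \<lfloor>x\<rfloor>)) else (\<lambda>x. ennreal (u2 ^ nat \<lfloor>x\<rfloor>)))" for i
    define \<tau> where "\<tau> i = (if i = 0 then t else grid_point n k)" for i :: nat
    have "(\<lambda>x::real. ennreal (u ^ nat \<lfloor>x\<rfloor>)) \<in> borel_measurable borel" for u :: real
      by measurable
    then have f_meas: "f i \<in> borel_measurable borel" for i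
      by (simp add: f_def indicator_grid_index_measurable)
    have "?lhs = (\<integral>\<^sup>+\<omega>. (\<Prod>i\<in>{..<3}. f i
        (([S, \<lambda>t \<omega>. real (N1 t \<omega>), \<lambda>t \<omega>. real (N2 t \<omega>)] ! i) (\<tau> i) \<omega>)) \<partial>M)"
      using u by (simp add: f_def \<tau>_def numeral_3_eq_3 lessThan_Suc ennreal_mult' mult_ac)
    also have "\<dots> = (\<Prod>i\<in>{..<3}. \<integral>\<^sup>+\<omega>. f i
        (([S, \<lambda>t \<omega>. real (N1 t \<omega>), \<lambda>t \<omega>. real (N2 t \<omega>)] ! i) (\<tau> i) \<omega>) \<partial>M)"
      using t f_meas less_imp_le[OF grid_point_pos]
      by (intro nn_integral_indep_processes[OF indep]) (auto simp: \<tau>_def)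
    also have "\<dots> = (\<integral>\<^sup>+\<omega>. indicator {k} (grid_index n (S t \<omega>)) \<partial>M) *
        ((\<integral>\<^sup>+\<omega>. ennreal (u1 ^ N1 (grid_point n k) \<omega>) \<partial>M) *
         (\<integral>\<^sup>+\<omega>. ennreal (u2 ^ N2 (grid_point n k) \<omega>) \<partial>M))"
      by (simp add: f_def \<tau>_def numeral_3_eq_3 lessThan_Suc mult_ac)
    also have "\<dots> = (\<integral>\<^sup>+\<omega>. indicator {k} (grid_index n (S t \<omega>)) \<partial>M) *
        ennreal (exp (- c * grid_point n k))"
      using u r by (simp add: poisson_process_pgf[OF N1] poisson_process_pgf[OF N2] c_def
          algebra_simps flip: ennreal_mult' exp_add)
    \<comment> \<open>The constant goes back under the integral so that the cells can be summed to
      the integral of \<open>exp (- c * D n \<omega>)\<close>.\<close>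
    also have "\<dots> = ?rhs"
      by (rule nn_integral_multc[symmetric]) measurable
    finally show ?thesis .
  qed

  have discrete: "expectation (\<lambda>\<omega>. u1 ^ N1 (D n \<omega>) \<omega> * u2 ^ N2 (D n \<omega>) \<omega>)
      = expectation (\<lambda>\<omega>. exp (- c * D n \<omega>))" for n
  proof -
    have "(\<integral>\<^sup>+\<omega>. ennreal (u1 ^ N1 (D n \<omega>) \<omega> * u2 ^ N2 (D n \<omega>) \<omega>) \<partial>M)
        = (\<Sum>k. \<integral>\<^sup>+\<omega>. indicator {k} (grid_index n (S t \<omega>)) *
            ennreal (u1 ^ N1 (grid_point n k) \<omega> * u2 ^ N2 (grid_point n k) \<omega>) \<partial>M)"
      unfolding D_def by (rule nn_integral_compose_count_space) measurable
    also have "\<dots> = (\<Sum>k. \<integral>\<^sup>+\<omega>. indicator {k} (grid_index n (S t \<omega>)) *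
            ennreal (exp (- c * grid_point n k)) \<partial>M)"
      by (simp only: cell)
    also have "\<dots> = (\<integral>\<^sup>+\<omega>. ennreal (exp (- c * D n \<omega>)) \<partial>M)"
      unfolding D_def by (rule nn_integral_compose_count_space[symmetric]) measurable
    finally show ?thesis
      using pw by (simp add: integral_eq_nn_integral)
  qed

  have "(\<lambda>n. expectation (\<lambda>\<omega>. u1 ^ N1 (D n \<omega>) \<omega> * u2 ^ N2 (D n \<omega>) \<omega>))
      \<longlonglongrightarrow> expectation (\<lambda>\<omega>. u1 ^ N1 (S t \<omega>) \<omega> * u2 ^ N2 (S t \<omega>) \<omega>)"
  proof (rule integral_dominated_convergence[where w = "\<lambda>_. 1"])
    show "AE \<omega> in M. (\<lambda>n. u1 ^ N1 (D n \<omega>) \<omega> * u2 ^ N2 (D n \<omega>) \<omega>)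
        \<longlonglongrightarrow> u1 ^ N1 (S t \<omega>) \<omega> * u2 ^ N2 (S t \<omega>) \<omega>"
    proof (rule AE_I2)
      fix \<omega> assume \<omega>: "\<omega> \<in> space M"
      have "\<forall>\<^sub>F n in sequentially. N1 (D n \<omega>) \<omega> = N1 (S t \<omega>) \<omega>"
        "\<forall>\<^sub>F n in sequentially. N2 (D n \<omega>) \<omega> = N2 (S t \<omega>) \<omega>"
        using \<omega> by (auto intro!: poisson_process_right_continuous[OF N1]
            poisson_process_right_continuous[OF N2] D_gt D_lim S_nn)
      \<comment> \<open>For a fixed outcome the integrands are eventually constant, so no continuity
        in the counts is involved.\<close>
      then have "\<forall>\<^sub>F n in sequentially. u1 ^ N1 (D n \<omega>) \<omega> * u2 ^ N2 (D n \<omega>) \<omega>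
          = u1 ^ N1 (S t \<omega>) \<omega> * u2 ^ N2 (S t \<omega>) \<omega>"
        by eventually_elim simp
      then show "(\<lambda>n. u1 ^ N1 (D n \<omega>) \<omega> * u2 ^ N2 (D n \<omega>) \<omega>)
          \<longlonglongrightarrow> u1 ^ N1 (S t \<omega>) \<omega> * u2 ^ N2 (S t \<omega>) \<omega>"
        by (rule tendsto_eventually)
    qed
  qed (use pw in \<open>auto simp del: mult_nonneg_nonneg\<close>)
  moreover have "(\<lambda>n. expectation (\<lambda>\<omega>. exp (- c * D n \<omega>)))
      \<longlonglongrightarrow> expectation (\<lambda>\<omega>. exp (- c * S t \<omega>))"
  proof (rule integral_dominated_convergence[where w = "\<lambda>_. 1"])
    show "AE \<omega> in M. (\<lambda>n. exp (- c * D n \<omega>)) \<longlonglongrightarrow> exp (- c * S t \<omega>)"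
      by (intro AE_I2 tendsto_intros D_lim)
    show "AE \<omega> in M. norm (exp (- c * D n \<omega>)) \<le> 1" for n
      using c D_pos[THEN less_imp_le] by (auto intro: mult_nonneg_nonneg)
  qed auto
  \<comment> \<open>By \<open>discrete\<close> the two sequences of expectations coincide, so their
    limits do too.\<close>
  ultimately show ?thesis
    unfolding discrete c_def[symmetric] by (rule LIMSEQ_unique)
qed

section \<open>Series form of the expectation and the closed form of the generating function\<close>

lemma expectation_eq_infsum:
  fixes f :: "'b :: countable \<Rightarrow> real"
  assumes X [measurable]: "X \<in> M \<rightarrow>\<^sub>M count_space UNIV" and f: "\<And>x. \<bar>f x\<bar> \<le> 1"
  shows "expectation (\<lambda>\<omega>. f (X \<omega>)) = (\<Sum>\<^sub>\<infinity>x. f x * prob {\<omega> \<in> space M. X \<omega> = x})"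
proof -
  let ?D = "distr M (count_space UNIV) X"
  interpret D: prob_space ?D
    by (rule prob_space_distr) fact
  \<comment> \<open>On a countable type almost every point is an atom; this is the defining
    condition that lets the law of \<open>X\<close> be viewed as a \<open>pmf\<close>.\<close>
  have "AE x in ?D. measure ?D {x} \<noteq> 0"
    by (subst D.AE_support_countable) (auto intro: exI[of _ UNIV])
  then have p: "measure_pmf (Abs_pmf ?D) = ?D"
    by (intro Abs_pmf_inverse) (simp add: D.prob_space_axioms)
  have pmf: "pmf (Abs_pmf ?D) x = prob {\<omega> \<in> space M. X \<omega> = x}" for x
    unfolding pmf.rep_eq p by (simp add: measure_distr vimage_def Int_def conj_commute)
  have "expectation (\<lambda>\<omega>. f (X \<omega>)) = integral\<^sup>L ?D f"
    by (simp add: integral_distr)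
  also have "\<dots> = infsetsum (\<lambda>x. pmf (Abs_pmf ?D) x * f x) UNIV"
    by (simp add: p flip: pmf_expectation_eq_infsetsum)
  also have "\<dots> = (\<Sum>\<^sub>\<infinity>x. pmf (Abs_pmf ?D) x * f x)"
  \<comment> \<open>The two notions of infinite sum agree under absolute summability, which holds
    since \<open>f\<close> is bounded by 1 and the probabilities are summable.\<close>
  proof (intro infsetsum_infsum Infinite_Set_Sum.abs_summable_on_comparison_test[OF pmf_abs_summable])
    fix x show "norm (pmf (Abs_pmf ?D) x * f x) \<le> norm (pmf (Abs_pmf ?D) x)"
      using f[of x] by (simp add: abs_mult mult_left_le)
  qed
  finally show ?thesis
    by (simp add: pmf mult.commute)
qed

lemma bivariate_tempered_space_fractional_poisson_pgf:
  assumes Q: "bivariate_tempered_space_fractional_poisson M \<alpha> \<theta> r1 r2 Q"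
    and r: "0 < r1" "0 < r2" and u: "u1 \<in> {0..1}" "u2 \<in> {0..1}" and t: "0 \<le> t"
  shows "bivariate_pgf M Q u1 u2 t =
    exp (- t * ((r1 * (1 - u1) + r2 * (1 - u2) + \<theta>) powr \<alpha> - \<theta> powr \<alpha>))"
proof -
  from Q obtain S N1 N2 where S: "tempered_stable_subordinator M \<alpha> \<theta> S"
    and N1: "poisson_process M r1 N1" and N2: "poisson_process M r2 N2"
    and indep: "indep_processes M ((!) [S, \<lambda>t \<omega>. real (N1 t \<omega>), \<lambda>t \<omega>. real (N2 t \<omega>)]) {..<3}"
    and Q_eq: "\<And>\<omega>. \<omega> \<in> space M \<Longrightarrow> Q t \<omega> = (N1 (S t \<omega>) \<omega>, N2 (S t \<omega>) \<omega>)"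
    using t unfolding bivariate_tempered_space_fractional_poisson_def bivariate_time_change_def
    by blast
  have S_meas: "S t \<in> borel_measurable M" and S_nn: "\<And>\<omega>. \<omega> \<in> space M \<Longrightarrow> 0 \<le> S t \<omega>"
    using S t unfolding tempered_stable_subordinator_def levy_subordinator_def levy_process_def
    by auto
  have [measurable]: "(\<lambda>\<omega>. N1 (S t \<omega>) \<omega>) \<in> M \<rightarrow>\<^sub>M count_space UNIV"
    "(\<lambda>\<omega>. N2 (S t \<omega>) \<omega>) \<in> M \<rightarrow>\<^sub>M count_space UNIV"
    by (intro poisson_process_random_time_measurable[OF N1 S_meas S_nn]
        poisson_process_random_time_measurable[OF N2 S_meas S_nn]; simp)+
  have "(\<lambda>\<omega>. (N1 (S t \<omega>) \<omega>, N2 (S t \<omega>) \<omega>)) \<in> M \<rightarrow>\<^sub>M count_space UNIV"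
    by measurable
  \<comment> \<open>\<open>Q t\<close> is known to equal the time change only on
    \<open>space M\<close>, which is enough for measurability.\<close>
  then have Q_meas: "Q t \<in> M \<rightarrow>\<^sub>M count_space UNIV"
    by (simp only: measurable_cong[OF Q_eq])
  have "\<bar>case k of (k1, k2) \<Rightarrow> u1 ^ k1 * u2 ^ k2\<bar> \<le> 1" for k :: "nat \<times> nat"
    using u by (auto simp: abs_mult split: prod.split intro!: mult_le_one power_le_one)
  from expectation_eq_infsum[OF Q_meas, of "\<lambda>(k1, k2). u1 ^ k1 * u2 ^ k2", OF this]
  have "bivariate_pgf M Q u1 u2 t = expectation (\<lambda>\<omega>. case Q t \<omega> of (k1, k2) \<Rightarrow> u1 ^ k1 * u2 ^ k2)"
    by (simp add: bivariate_pgf_def case_prod_beta')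
  also have "\<dots> = expectation (\<lambda>\<omega>. u1 ^ N1 (S t \<omega>) \<omega> * u2 ^ N2 (S t \<omega>) \<omega>)"
    by (intro Bochner_Integration.integral_cong) (auto simp: Q_eq)
  also have "\<dots> = expectation (\<lambda>\<omega>. exp (- (r1 * (1 - u1) + r2 * (1 - u2)) * S t \<omega>))"
    by (rule expectation_subordinated_poisson_processes[OF N1 N2 r u t S_meas S_nn indep])
  also have "\<dots> = exp (- t * ((r1 * (1 - u1) + r2 * (1 - u2) + \<theta>) powr \<alpha> - \<theta> powr \<alpha>))"
  proof -
    \<comment> \<open>The Laplace transform of \<open>S t\<close> is prescribed only at nonnegative
      arguments.\<close>
    have "0 \<le> r1 * (1 - u1) + r2 * (1 - u2)"
      using r u by simp
    then show ?thesis
      using S t unfolding tempered_stable_subordinator_def by blast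
  qed
  finally show ?thesis .
qed

end

theorem theorem3p1:
  fixes M :: "'a measure"
    and Q :: "real \<Rightarrow> 'a \<Rightarrow> nat \<times> nat"
    and \<alpha> \<theta> r1 r2 u1 u2 t :: real
  assumes "prob_space M"
    and "0 < \<alpha>" and "\<alpha> < 1" and "0 < \<theta>" and "0 < r1" and "0 < r2"
    and "bivariate_tempered_space_fractional_poisson M \<alpha> \<theta> r1 r2 Q"
    and "u1 \<in> {0..1}" and "u2 \<in> {0..1}" and "0 \<le> t"
  shows "bivariate_pgf M Q u1 u2 t =
           exp (- t * ((r1 * (1 - u1) + r2 * (1 - u2) + \<theta>) powr \<alpha> - \<theta> powr \<alpha>)) \<and>
         (bivariate_pgf M Q u1 u2 has_real_derivative
            - ((r1 * (1 - u1) + r2 * (1 - u2) + \<theta>) powr \<alpha> - \<theta> powr \<alpha>) * bivariate_pgf M Q u1 u2 t)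
            (at t within {0..}) \<and>
         bivariate_pgf M Q u1 u2 0 = 1"
proof -
  interpret prob_space M by fact
  define b where "b = (r1 * (1 - u1) + r2 * (1 - u2) + \<theta>) powr \<alpha> - \<theta> powr \<alpha>"
  \<comment> \<open>The closed form is needed at all nonnegative times, since the derivative
    compares values near \<open>t\<close>.\<close>
  have pgf: "bivariate_pgf M Q u1 u2 s = exp (- s * b)" if "0 \<le> s" for s
    unfolding b_def using assms that by (intro bivariate_tempered_space_fractional_poisson_pgf)
  have "((\<lambda>s. exp (- s * b)) has_real_derivative - b * exp (- t * b)) (at t within {0..})"
    by (auto intro!: derivative_eq_intros)
  then have "(bivariate_pgf M Q u1 u2 has_real_derivative - b * exp (- t * b)) (at t within {0..})"
    \<comment> \<open>The two functions of time are compared on nonnegative times only, so the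
      derivative is taken within \<open>{0..}\<close> and is one-sided at 0. The radius 1 is
      arbitrary.\<close>
    by (rule has_field_derivative_transform_within[of _ _ _ _ 1]) (use pgf \<open>0 \<le> t\<close> in auto)
  then show ?thesis
    using pgf[of t] pgf[of 0] \<open>0 \<le> t\<close> by (simp flip: b_def)
qed

end
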